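(* Let $a,b$ be coprime positive integers, $n\ge1$, $P\in\mathfrak{D}_n^{(a,b)}$, and let $P_0$ be the lowest path of $\mathfrak{D}_n^{(a,b)}$. Let $\mathfrak{B}=B(P,P_0)$, and let $\widetilde{\mathfrak{B}}$ be the binary tree obtained from $\mathfrak{B}$ by dividing every left edge into $b$ pieces and attaching $(a-1)bn$ right edges at the right-most node. For $i\in\{1,2\}$ write $\omega_i(\widetilde{\mathfrak{B}})=(\omega_i(1),\ldots,\omega_i(2abn))\in\{N,E\}^{2abn}$, and for $1\le j\le b$ put $$\mathfrak{d}^{(i)}_j=(\omega_i(b+1-j),\omega_i(2b+1-j),\ldots,\omega_i(2abn+1-j)),\qquad \mathfrak{d}^{(i)}=(\mathfrak{d}^{(i)}_1,\ldots,\mathfrak{d}^{(i)}_b).$$ Then: (1) $\mathfrak{d}^{(1)}=\alpha^{II}(P)$; (2) $\mathfrak{d}^{(2)}=\alpha^{II}(P_0)$.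
   Context: **Dyck paths.** $\mathfrak{D}_n^{(a,b)}$ is the set of lattice paths from $(0,0)$ to $(bn,an)$ with unit steps $N=(0,1)$, $E=(1,0)$ staying weakly above $y=ax/b$. The step sequence $(u_1,\ldots,u_{an})$ records the $x$-coordinate $u_k$ of the $k$-th $N$ step. The lowest path $P_0$ has step sequence $u_k=\lfloor b(k-1)/a\rfloor$. **Binary trees.** A binary tree is a rooted tree in which each node has at most one left child and at most one right child; edges are left or right edges. The word $\omega(T)$ is read by walking around $T$ counterclockwise from the root: at a node $x$, $\omega(x)$ is $1\,\omega(y)\,\bar1$ for the left child $y$ (if any) followed by $2\,\omega(z)\,\bar2$ for the right child $z$ (if any). $\omega_1(T)$ is obtained by deleting all $1$'s and $2$'s, $\omega_2(T)$ by deleting all $1$'s and $\bar2$'s; then $\bar1$ is replaced by $N$ and $2,\bar2$ by $E$. $B(P,P_0)$ is the (unique) binary tree with $(a+b)n$ edges such that $\omega_1(B(P,P_0))=P$ and $\omega_2(B(P,P_0))=P_0$. Dividing a left edge into $b$ pieces means replacing it by a chain of $b$ left edges. The right-most node is the last node reached from the root by following right edges only; the $(a-1)bn$ right edges are attached there as a chain of consecutive right edges. **Type $II$.** $\zeta(\mathfrak{u}_P)$ is the word obtained from the empty word by inserting, for $k=1,\ldots,an$, the block $k^b$ right after the first $u_k$ letters of the current word. For a word $\pi$ in which each occurring letter occurs $b$ times and no smaller letter lies between two equal letters, put $\alpha^\ast(\emptyset)=\emptyset$ and, if $r$ is the smallest letter and $\pi=\pi^0r\pi^1r\cdots r\pi^b$,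 $\alpha^\ast(\pi)=(\,\alpha^\ast(\pi^0)\ast\alpha^\ast(\pi^1)\ast\cdots\ast\alpha^\ast(\pi^b)\,)$. Label all stars of $\alpha^\ast(\pi)$ from right to left by $1,\ldots,b,1,\ldots,b,\ldots$, ignoring the parentheses. For $1\le i\le b$, $\alpha^{II}_i(\pi)$ is obtained by erasing all ")" and all stars not labeled $i$, and replacing the remaining stars by ")"; read "(" as $N$, ")" as $E$. $\alpha^{II}(\pi)=(\alpha^{II}_1(\pi),\ldots,\alpha^{II}_b(\pi))$ and $\alpha^{II}(P):=\alpha^{II}(\zeta(\mathfrak{u}_P))$. *)

theory Defs
  imports Main
begin

section \<open>Rational Dyck paths\<close>

datatype step = N | E

text \<open>
  A path from the origin is its list of steps; after \<open>k\<close> steps it is at the point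
  \<open>(count_list (take k P) E, count_list (take k P) N)\<close>.  Since the steps are unit segments, staying
  weakly above \<open>y = a x / b\<close> is a condition on these lattice points, multiplied out by \<open>b > 0\<close>.
\<close>

definition dyck_paths :: "nat \<Rightarrow> nat \<Rightarrow> nat \<Rightarrow> step list set" where
  "dyck_paths a b n =
     {P. count_list P E = b * n \<and> count_list P N = a * n \<and>
         (\<forall>k\<le>length P. a * count_list (take k P) E \<le> b * count_list (take k P) N)}"

fun step_seq_from :: "nat \<Rightarrow> step list \<Rightarrow> nat list" where
  "step_seq_from x [] = []"
| "step_seq_from x (N # P) = x # step_seq_from x P"
| "step_seq_from x (E # P) = step_seq_from (Suc x) P"

text \<open>The list position \<open>k\<close> holds $u_{k+1}$.\<close>

definition step_seq :: "step list \<Rightarrow> nat list" where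
  "step_seq P = step_seq_from 0 P"

text \<open>
  A path in \<^term>\<open>dyck_paths a b n\<close> is determined by its step sequence; for positive \<open>a\<close>, \<open>b\<close> the
  sequence below is attained.
\<close>

definition lowest_path :: "nat \<Rightarrow> nat \<Rightarrow> nat \<Rightarrow> step list" where
  "lowest_path a b n =
     (THE P. P \<in> dyck_paths a b n \<and> step_seq P = map (\<lambda>k. b * k div a) [0..<a * n])"

section \<open>Binary trees\<close>

text \<open>A tree always has a root; an absent left or right child is \<^term>\<open>None\<close>.\<close>

datatype btree = Node (left: "btree option") (right: "btree option")

fun edges :: "btree \<Rightarrow> nat" where
  "edges (Node l r) =
     (case l of None \<Rightarrow> 0 | Some y \<Rightarrow> Suc (edges y)) +
     (case r of None \<Rightarrow> 0 | Some z \<Rightarrow> Suc (edges z))"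

text \<open>\<open>One\<close>, \<open>OneBar\<close>, \<open>Two\<close>, \<open>TwoBar\<close> are the letters $1, \bar 1, 2, \bar 2$.\<close>

datatype letter = One | OneBar | Two | TwoBar

fun tree_word :: "btree \<Rightarrow> letter list" where
  "tree_word (Node l r) =
     (case l of None \<Rightarrow> [] | Some y \<Rightarrow> One # tree_word y @ [OneBar]) @
     (case r of None \<Rightarrow> [] | Some z \<Rightarrow> Two # tree_word z @ [TwoBar])"

text \<open>In the next two functions \<^term>\<open>None\<close> marks the letters to be deleted.\<close>

fun letter_step1 :: "letter \<Rightarrow> step option" where
  "letter_step1 One = None"
| "letter_step1 Two = None"
| "letter_step1 OneBar = Some N"
| "letter_step1 TwoBar = Some E"

fun letter_step2 :: "letter \<Rightarrow> step option" where
  "letter_step2 One = None"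
| "letter_step2 TwoBar = None"
| "letter_step2 OneBar = Some N"
| "letter_step2 Two = Some E"

definition omega1 :: "btree \<Rightarrow> step list" where
  "omega1 T = List.map_filter letter_step1 (tree_word T)"

definition omega2 :: "btree \<Rightarrow> step list" where
  "omega2 T = List.map_filter letter_step2 (tree_word T)"

text \<open>
  The tree $B(P, P_0)$ is \<open>tree_of_paths ((a + b) * n) P P\<^sub>0\<close>; it exists and is unique
  for $P$ in \<^term>\<open>dyck_paths a b n\<close>.
\<close>

definition tree_of_paths :: "nat \<Rightarrow> step list \<Rightarrow> step list \<Rightarrow> btree" where
  "tree_of_paths m P Q = (THE T. edges T = m \<and> omega1 T = P \<and> omega2 T = Q)"

text \<open>
  Dividing a left edge from \<open>x\<close> to \<open>y\<close> into \<open>b \<ge> 1\<close> pieces puts \<open>b - 1\<close> new nodes between \<open>x\<close>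
  and \<open>y\<close>, each having a left child only.
\<close>

fun divide_left :: "nat \<Rightarrow> btree \<Rightarrow> btree" where
  "divide_left b (Node l r) =
     Node (case l of None \<Rightarrow> None
                   | Some y \<Rightarrow> Some (((\<lambda>t. Node (Some t) None) ^^ (b - 1)) (divide_left b y)))
          (case r of None \<Rightarrow> None | Some z \<Rightarrow> Some (divide_left b z))"

fun attach_right_edge :: "btree \<Rightarrow> btree" where
  "attach_right_edge (Node l None) = Node l (Some (Node None None))"
| "attach_right_edge (Node l (Some z)) = Node l (Some (attach_right_edge z))"

text \<open>The new node is again the right-most one, so iteration attaches a chain of right edges.\<close>

definition attach_right_edges :: "nat \<Rightarrow> btree \<Rightarrow> btree" where
  "attach_right_edges m T = (attach_right_edge ^^ m) T"

definition expanded_tree :: "nat \<Rightarrow> nat \<Rightarrow> nat \<Rightarrow> step list \<Rightarrow> btree" where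
  "expanded_tree a b n P =
     attach_right_edges ((a - 1) * b * n)
       (divide_left b (tree_of_paths ((a + b) * n) P (lowest_path a b n)))"

text \<open>
  For a word \<open>w\<close> of length \<open>b * m\<close> and \<open>1 \<le> j \<le> b\<close>, the subword of the letters of \<open>w\<close> at the
  (1-based) positions $b + 1 - j, 2b + 1 - j, \ldots, mb + 1 - j$; the 1-based position
  $kb + 1 - j$ is the list index \<open>k * b - j\<close>.
\<close>

definition residue_word :: "nat \<Rightarrow> nat \<Rightarrow> step list \<Rightarrow> nat \<Rightarrow> step list" where
  "residue_word b m w j = map (\<lambda>k. w ! (k * b - j)) [1..<Suc m]"

definition residue_words :: "nat \<Rightarrow> nat \<Rightarrow> step list \<Rightarrow> step list list" where
  "residue_words b m w = map (residue_word b m w) [1..<Suc b]"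

section \<open>The decomposition of type II\<close>

definition insert_block :: "nat \<Rightarrow> nat \<times> nat \<Rightarrow> nat list \<Rightarrow> nat list" where
  "insert_block b = (\<lambda>(k, u) w. take u w @ replicate b k @ drop u w)"

definition zeta :: "nat \<Rightarrow> nat list \<Rightarrow> nat list" where
  "zeta b us = fold (insert_block b) (zip [1..<Suc (length us)] us) []"

text \<open>
  \<open>split_at r \<pi>\<close> is the list $[\pi^0, \ldots, \pi^m]$ for
  $\pi = \pi^0 r \pi^1 r \cdots r \pi^m$ with no $r$ in the $\pi^i$.
\<close>

fun split_at :: "'a \<Rightarrow> 'a list \<Rightarrow> 'a list list" where
  "split_at r [] = [[]]"
| "split_at r (x # xs) =
     (if x = r then [] # split_at r xs
      else (x # hd (split_at r xs)) # tl (split_at r xs))"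

lemma split_at_not_Nil [simp]: "split_at r xs \<noteq> []"
  by (cases xs) auto

lemma length_split_at_le: "p \<in> set (split_at r xs) \<Longrightarrow> length p \<le> length xs"
proof (induction xs arbitrary: p)
  case (Cons x xs)
  have "hd (split_at r xs) \<in> set (split_at r xs)" by simp
  moreover have "set (tl (split_at r xs)) \<subseteq> set (split_at r xs)"
    by (meson list.set_sel(2) split_at_not_Nil subsetI)
  ultimately show ?case
    using Cons by (fastforce split: if_splits intro: le_SucI)
qed simp

lemma length_split_at_less:
  "r \<in> set xs \<Longrightarrow> p \<in> set (split_at r xs) \<Longrightarrow> length p < length xs"
proof (induction xs arbitrary: p)
  case (Cons x xs)
  have hd: "hd (split_at r xs) \<in> set (split_at r xs)" by simp
  have tl: "set (tl (split_at r xs)) \<subseteq> set (split_at r xs)"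
    by (meson list.set_sel(2) split_at_not_Nil subsetI)
  show ?case
  proof (cases "x = r")
    case True
    then show ?thesis
      using Cons.prems(2) length_split_at_le[of p r xs] by auto
  next
    case False
    then have "r \<in> set xs" using Cons.prems(1) by simp
    then show ?thesis
      using Cons.prems(2) Cons.IH hd tl False by (fastforce intro: less_SucI)
  qed
qed simp

datatype symbol = LParen | RParen | Star

fun join :: "'a \<Rightarrow> 'a list list \<Rightarrow> 'a list" where
  "join s [] = []"
| "join s [w] = w"
| "join s (w # v # ws) = w @ s # join s (v # ws)"

function alpha_star :: "nat list \<Rightarrow> symbol list" where
  "alpha_star \<pi> =
     (if \<pi> = [] then []
      else LParen # join Star (map alpha_star (split_at (Min (set \<pi>)) \<pi>)) @ [RParen])"
  by auto
termination
  by (relation "measure length") (auto intro!: length_split_at_less[OF Min_in])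

declare alpha_star.simps [simp del]

text \<open>
  The label of a star is determined by the number of stars to its right, since stars are labelled
  from right to left by $1, \ldots, b, 1, \ldots, b, \ldots$.
\<close>

fun select_stars :: "nat \<Rightarrow> nat \<Rightarrow> symbol list \<Rightarrow> step list" where
  "select_stars b i [] = []"
| "select_stars b i (LParen # w) = N # select_stars b i w"
| "select_stars b i (RParen # w) = select_stars b i w"
| "select_stars b i (Star # w) =
     (if count_list w Star mod b + 1 = i then E # select_stars b i w else select_stars b i w)"

definition alpha_II_word :: "nat \<Rightarrow> nat list \<Rightarrow> step list list" where
  "alpha_II_word b \<pi> = map (\<lambda>i. select_stars b i (alpha_star \<pi>)) [1..<Suc b]"

definition alpha_II :: "nat \<Rightarrow> step list \<Rightarrow> step list list" where
  "alpha_II b P = alpha_II_word b (zeta b (step_seq P))"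

end

theory Submission
  imports Defs
begin

text \<open>
  Both equations are instances of one statement about a single path.  Dividing the left edges
  replaces every \<open>N\<close> of \<open>omega1\<close> and \<open>omega2\<close> by \<open>b\<close> copies, and every right edge attached at the
  right-most node adds one \<open>E\<close> at the end of both words.  Since \<open>omega1\<close> and \<open>omega2\<close> of $B(P, P_0)$
  are \<open>P\<close> and $P_0$, it suffices to show that for every path \<open>Q\<close> in \<^term>\<open>dyck_paths a b n\<close> the residue words
  of the word stretched and extended from \<open>Q\<close> are \<^term>\<open>alpha_II b Q\<close> (\<open>residue_words_stretch_N\<close>).

  This statement rests on two observations.  First, if one drops the closing parentheses of
  $\alpha^\ast(\zeta(\mathfrak u_Q))$ and reads an opening one as \<open>N\<close> and a star as \<open>E\<close>, one gets \<open>Q\<close>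
  followed by \<open>E\<close>s (\<open>alpha_path_zeta\<close>): inserting a block of a new largest letter after \<open>u\<close> letters
  inserts \<open>N\<close> and \<open>b\<close> stars just before the next star after the first \<open>u\<close> stars, and the \<open>u\<close>s are
  weakly increasing.  Secondly, the letters at positions of a fixed residue modulo \<open>b\<close> in the
  stretched word contain exactly one \<open>N\<close> of each group of \<open>b\<close> copies, and
  contain an \<open>E\<close> exactly when the number of \<open>E\<close>s to its right has the prescribed residue, that is,
  when the corresponding star has the prescribed label (\<open>pick_residue_stretch_N\<close>).

  It remains to justify the definite descriptions.  The lowest path is constructed from its step sequence,
  and \<open>P\<close> lies weakly above it.  For two paths \<open>P\<close>, \<open>Q\<close> with the same end points and \<open>P\<close> weakly above
  \<open>Q\<close> there is exactly one binary tree with the words \<open>P\<close> and \<open>Q\<close>.  With a left subtree \<open>y\<close>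
  and a right subtree \<open>z\<close> these words are $\omega_1(y)\,N\,\omega_1(z)\,E$ and
  $\omega_2(y)\,N\,E\,\omega_2(z)$; without a right subtree both are empty or end in
  \<open>N\<close>.  So the last letter of \<open>P\<close>
  decides whether there is a right subtree, and the point where the words split is the last common
  point of the two paths that is the origin or is reached by a step \<open>N\<close> of \<open>P\<close> (\<open>split_unique\<close>,
  \<open>weakly_above_splitE\<close>).
\<close>

section \<open>Words of the expanded tree\<close>

lemma omega1_Node:
  "omega1 (Node l r) =
     (case l of None \<Rightarrow> [] | Some y \<Rightarrow> omega1 y @ [N]) @
     (case r of None \<Rightarrow> [] | Some z \<Rightarrow> omega1 z @ [E])"
  by (auto simp: omega1_def List.map_filter_def split: option.splits)

lemma omega2_Node:
  "omega2 (Node l r) =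
     (case l of None \<Rightarrow> [] | Some y \<Rightarrow> omega2 y @ [N]) @
     (case r of None \<Rightarrow> [] | Some z \<Rightarrow> E # omega2 z)"
  by (auto simp: omega2_def List.map_filter_def split: option.splits)

definition stretch_N :: "nat \<Rightarrow> step list \<Rightarrow> step list" where
  "stretch_N b P = concat (map (\<lambda>s. case s of N \<Rightarrow> replicate b N | E \<Rightarrow> [E]) P)"

lemma stretch_N_simps [simp]:
  "stretch_N b [] = []"
  "stretch_N b (N # P) = replicate b N @ stretch_N b P"
  "stretch_N b (E # P) = E # stretch_N b P"
  "stretch_N b (P @ Q) = stretch_N b P @ stretch_N b Q"
  by (simp_all add: stretch_N_def)

lemma stretch_N_replicate_E [simp]: "stretch_N b (replicate m E) = replicate m E"
  by (induction m) auto

lemma omega_left_chain: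
  "omega1 (((\<lambda>t. Node (Some t) None) ^^ m) T) = omega1 T @ replicate m N"
  "omega2 (((\<lambda>t. Node (Some t) None) ^^ m) T) = omega2 T @ replicate m N"
  by (induction m) (simp_all add: omega1_Node omega2_Node replicate_append_same)

lemma omega_divide_left:
  assumes "b > 0"
  shows "omega1 (divide_left b T) = stretch_N b (omega1 T)"
    and "omega2 (divide_left b T) = stretch_N b (omega2 T)"
proof -
  have b: "replicate (b - 1) N @ [N] = replicate b N"
    using assms by (cases b) (simp_all add: replicate_append_same)
  have "omega1 (divide_left b T) = stretch_N b (omega1 T) \<and>
        omega2 (divide_left b T) = stretch_N b (omega2 T)"
    by (induction T rule: tree_word.induct)
      (auto simp: omega1_Node omega2_Node omega_left_chain b[simplified] split: option.splits)
  then show "omega1 (divide_left b T) = stretch_N b (omega1 T)"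
    and "omega2 (divide_left b T) = stretch_N b (omega2 T)" by auto
qed

text \<open>
  The letters \<open>Two\<close>, \<open>TwoBar\<close> of the new edge are adjacent, and all letters behind them are
  \<open>TwoBar\<close>: in \<open>omega1\<close> the new \<open>E\<close> joins a final run of \<open>E\<close>s, and in \<open>omega2\<close> nothing
  remains behind it.
\<close>

lemma omega_attach_right_edge:
  "omega1 (attach_right_edge T) = omega1 T @ [E]"
  "omega2 (attach_right_edge T) = omega2 T @ [E]"
  by (induction T rule: attach_right_edge.induct) (auto simp: omega1_Node omega2_Node)

lemma omega_attach_right_edges:
  "omega1 (attach_right_edges m T) = omega1 T @ replicate m E"
  "omega2 (attach_right_edges m T) = omega2 T @ replicate m E"
  unfolding attach_right_edges_def
  by (induction m) (simp_all add: omega_attach_right_edge replicate_append_same)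

section \<open>The binary tree of a pair of non-crossing paths\<close>

abbreviation height :: "nat \<Rightarrow> step list \<Rightarrow> nat" where
  "height k P \<equiv> count_list (take k P) N"

definition weakly_above :: "step list \<Rightarrow> step list \<Rightarrow> bool" where
  "weakly_above P Q \<longleftrightarrow>
     length P = length Q \<and> count_list P N = count_list Q N \<and> (\<forall>k. height k Q \<le> height k P)"

lemma height_Suc:
  "k < length P \<Longrightarrow> height (Suc k) P = height k P + (if P ! k = N then 1 else 0)"
  by (simp add: take_Suc_conv_app_nth)

lemma height_le_count: "height k P \<le> count_list P N"
  by (metis append_take_drop_id count_list_append le_add1)

lemma weakly_above_Nil: "weakly_above [] []"
  by (simp add: weakly_above_def)

lemma weakly_above_append:
  assumes "weakly_above P Q" "weakly_above P' Q'"
  shows "weakly_above (P @ P') (Q @ Q')"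
  using assms by (auto simp: weakly_above_def add_mono)

text \<open>
  These are the words contributed by a right edge: \<open>omega1\<close> reads it when it is left, \<open>omega2\<close> when it is entered.
\<close>

lemma weakly_above_E_shift:
  assumes "weakly_above P Q"
  shows "weakly_above (P @ [E]) (E # Q)"
proof -
  have "height k (E # Q) \<le> height k (P @ [E])" for k
  proof (cases k)
    case (Suc j)
    have "height j Q \<le> height k Q"
      by (metis Suc le_add1 Suc_eq_plus1 take_add count_list_append)
    also have "\<dots> \<le> height k P" using assms by (simp add: weakly_above_def)
    finally show ?thesis using Suc by simp
  qed simp
  with assms show ?thesis by (auto simp: weakly_above_def)
qed

lemma omega_weakly_above: "weakly_above (omega1 T) (omega2 T)"
proof (induction T rule: tree_word.induct)
  case (1 l r)
  have NN: "weakly_above [N] [N]" by (simp add: weakly_above_def)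
  show ?case unfolding omega1_Node omega2_Node
    using 1 NN
    by (intro weakly_above_append)
      (auto split: option.splits intro: weakly_above_Nil weakly_above_append weakly_above_E_shift)
qed

lemma edges_eq_length_omega1: "edges T = length (omega1 T)"
  by (induction T rule: edges.induct) (auto simp: omega1_Node split: option.splits)

text \<open>
  In the part of the two words that comes from a right edge, the lower path is one \<open>E\<close> ahead.  Hence
  \<open>P\<close> cannot arrive at a common point by \<open>N\<close>: one step earlier it would be below \<open>Q\<close>.
\<close>

lemma shifted_meeting_after_E:
  assumes PQ: "weakly_above P Q" and j: "j \<le> length P"
    and meet: "height (Suc j) (P @ [E]) = height (Suc j) (E # Q)"
  shows "(P @ [E]) ! j = E"
proof (cases "j = length P")
  case False
  with j have j: "j < length P" by simp
  have "height j Q \<le> height j P" using PQ by (simp add: weakly_above_def)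
  moreover have "height (Suc j) P = height j Q" using meet j by simp
  ultimately have "P ! j \<noteq> N" using height_Suc[OF j] by auto
  then show ?thesis using j by (cases "P ! j") (auto simp: nth_append)
qed simp

lemma meeting_after_N_le_split:
  assumes PQ: "weakly_above P Q"
    and AB: "length A = length B" "count_list A N = count_list B N"
    and j: "j < length (A @ P @ [E])"
    and meet: "height (Suc j) (A @ P @ [E]) = height (Suc j) (B @ E # Q)"
    and N: "(A @ P @ [E]) ! j = N"
  shows "j < length A"
proof (rule ccontr)
  assume "\<not> j < length A"
  then obtain i where i: "j = length A + i" using le_Suc_ex not_less by blast
  have "i \<le> length P" using i j by simp
  moreover have "height (Suc i) (P @ [E]) = height (Suc i) (E # Q)"
    using meet AB by (simp add: i)
  ultimately have "(P @ [E]) ! i = E" using PQ shifted_meeting_after_E by blast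
  then show False using N by (simp add: i nth_append)
qed

text \<open>
  By the preceding lemma each of the two splittings lies at the last common point reached by \<open>N\<close>, so they
  coincide.
\<close>

lemma split_unique:
  assumes PQ: "weakly_above P Q" "weakly_above P' Q'"
    and AB: "weakly_above A B" "weakly_above A' B'"
    and last: "A = [] \<or> last A = N" "A' = [] \<or> last A' = N"
    and eq: "A @ P @ [E] = A' @ P' @ [E]" "B @ E # Q = B' @ E # Q'"
  shows "A = A' \<and> P = P' \<and> B = B' \<and> Q = Q'"
proof -
  have le: "length A' \<le> length A"
    if PQ: "weakly_above P Q" "weakly_above P' Q'"
    and AB: "weakly_above A B" "weakly_above A' B'"
    and last: "A' = [] \<or> last A' = N"
    and eq: "A @ P @ [E] = A' @ P' @ [E]" "B @ E # Q = B' @ E # Q'"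
  for A P B Q A' P' B' Q'
  proof (cases "A' = []")
    case False
    define j where "j = length A' - 1"
    have j: "Suc j = length A'" using False by (simp add: j_def)
    have "j < length A"
    proof (rule meeting_after_N_le_split[of P Q])
      show "j < length (A @ P @ [E])" unfolding eq(1) using j by simp
      show "(A @ P @ [E]) ! j = N"
        unfolding eq(1) using last False by (simp add: nth_append j_def last_conv_nth)
      have "length B' = Suc j" using AB(2) j by (simp add: weakly_above_def)
      then show "height (Suc j) (A @ P @ [E]) = height (Suc j) (B @ E # Q)"
        unfolding eq using AB(2) j by (simp add: weakly_above_def)
    qed (use PQ AB in \<open>auto simp: weakly_above_def\<close>)
    then show ?thesis using j by simp
  qed simp
  have len: "length A = length A'"
    using le[OF PQ AB last(2) eq] le[OF PQ(2,1) AB(2,1) last(1) eq[symmetric]] by simp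
  then have "length B = length B'" using AB by (simp add: weakly_above_def)
  with len eq show ?thesis by simp
qed

text \<open>
  The last letter of \<open>omega1\<close> tells whether there is a right subtree, and \<open>split_unique\<close> separates the
  words of the two subtrees.
\<close>

lemma omega_inj:
  assumes "omega1 T = omega1 T'" "omega2 T = omega2 T'"
  shows "T = T'"
  using assms
proof (induction T arbitrary: T' rule: tree_word.induct)
  case (1 l r)
  obtain l' r' where T': "T' = Node l' r'" by (cases T')
  let ?A = "\<lambda>l. case l of None \<Rightarrow> [] | Some y \<Rightarrow> omega1 y @ [N]"
  let ?B = "\<lambda>l. case l of None \<Rightarrow> [] | Some y \<Rightarrow> omega2 y @ [N]"
  have above: "weakly_above (?A l) (?B l)" for l
    using omega_weakly_above[of "Node l None"] by (simp add: omega1_Node omega2_Node)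
  have last: "?A l = [] \<or> last (?A l) = N" for l by (auto split: option.splits)
  have left: "l = l'" if "?A l = ?A l'" "?B l = ?B l'"
    using that 1(1) by (auto split: option.splits)
  have eq: "?A l @ (case r of None \<Rightarrow> [] | Some z \<Rightarrow> omega1 z @ [E]) =
      ?A l' @ (case r' of None \<Rightarrow> [] | Some z \<Rightarrow> omega1 z @ [E])"
    "?B l @ (case r of None \<Rightarrow> [] | Some z \<Rightarrow> E # omega2 z) =
      ?B l' @ (case r' of None \<Rightarrow> [] | Some z \<Rightarrow> E # omega2 z)"
    using 1(3,4) by (simp_all only: T' omega1_Node omega2_Node)
  show ?case
  proof (cases r)
    case None
    then have "r' = None"
      using eq(1) last[of l] by (auto split: option.splits)
    with None eq left show ?thesis by (simp add: T')
  next
    case (Some z)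
    then obtain z' where z': "r' = Some z'"
      using eq(1) last[of l'] by (cases r') (auto split: option.splits)
    have "?A l = ?A l' \<and> omega1 z = omega1 z' \<and> ?B l = ?B l' \<and> omega2 z = omega2 z'"
      by (rule split_unique) (use eq Some z' above last omega_weakly_above in simp_all)
    then show ?thesis using left 1(2)[OF Some] by (auto simp: T' Some z')
  qed
qed

text \<open>
  The splitting point is the last common point that is the origin or is reached by a step \<open>N\<close> of the upper
  path.  There the lower path continues with \<open>E\<close>, for otherwise both paths would step \<open>N\<close> to a later
  such point.  The same argument applies wherever the remaining parts, compared without the shift,
  would cross.
\<close>

lemma weakly_above_splitE:
  assumes PQ: "weakly_above (P @ [E]) Q"
  obtains A P' B Q' where "P = A @ P'" "Q = B @ E # Q'" "weakly_above A B" "weakly_above P' Q'"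
    "A = [] \<or> last A = N"
proof -
  let ?P = "P @ [E]"
  define S where "S = {k. k \<le> length P \<and> height k ?P = height k Q \<and> (k = 0 \<or> ?P ! (k - 1) = N)}"
  define k where "k = Max S"
  have fin: "finite S" by (rule finite_subset[of _ "{..length P}"]) (auto simp: S_def)
  have "0 \<in> S" by (simp add: S_def)
  then have kS: "k \<in> S" unfolding k_def using fin by (intro Max_in) auto
  have len: "length Q = Suc (length P)"
    and cnt: "count_list ?P N = count_list Q N"
    and above: "height i Q \<le> height i ?P" for i
    using PQ by (auto simp: weakly_above_def)
  have k: "k \<le> length P" "height k ?P = height k Q" "k = 0 \<or> ?P ! (k - 1) = N"
    using kS by (auto simp: S_def)
  have no_later: False
    if "k \<le> i" "i \<le> length P" "height i ?P = height i Q" "Q ! i = N" for i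
  proof -
    have *: "height (Suc i) Q = Suc (height i Q)" using that len by (subst height_Suc) auto
    have **: "height (Suc i) ?P = height i ?P + (if ?P ! i = N then 1 else 0)"
      using that by (subst height_Suc) auto
    have N: "?P ! i = N"
      using above[of "Suc i"] * ** that(3) by (auto split: if_splits)
    then have "i \<noteq> length P" by auto
    then have "Suc i \<in> S" using that N * ** by (auto simp: S_def)
    then have "Suc i \<le> k" unfolding k_def using fin by simp
    then show False using that by simp
  qed
  have "Q ! k \<noteq> N" using no_later[of k] k by auto
  then have Qk: "Q ! k = E" by (cases "Q ! k") auto
  define A where "A = take k P"
  define P' where "P' = drop k P"
  define B where "B = take k Q"
  define Q' where "Q' = drop (Suc k) Q"
  have P: "P = A @ P'" by (simp add: A_def P'_def)
  have Q: "Q = B @ E # Q'"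
    using id_take_nth_drop[of k Q] Qk k(1) len by (simp add: B_def Q'_def)
  have lenAB: "length A = k" "length B = k" using k(1) len by (auto simp: A_def B_def)
  have cntAB: "count_list A N = count_list B N" using k(1,2) by (simp add: A_def B_def)
  have AB: "weakly_above A B"
  proof -
    have "height i B \<le> height i A" for i
      using above[of "min i k"] k(1) by (simp add: A_def B_def)
    then show ?thesis using lenAB cntAB by (simp add: weakly_above_def)
  qed
  have lastA: "A = [] \<or> last A = N"
    using k(1,3) lenAB by (cases "A = []") (auto simp: P last_conv_nth nth_append)
  have len': "length P' = length Q'" using len lenAB P Q by simp
  have meet: "height (k + i) ?P = count_list A N + height i (P' @ [E])"
    "height (k + i) Q = count_list A N + height i (E # Q')" for i
    using lenAB cntAB by (simp_all add: P Q)
  have "height i Q' \<le> height i P'" for i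
  proof (rule ccontr)
    assume less: "\<not> height i Q' \<le> height i P'"
    \<comment> \<open>The shifted paths do not cross, so at a violation they touch and \<open>Q'\<close> has just stepped \<open>N\<close>.\<close>
    \<comment> \<open>In \<open>Q\<close>, which is one \<open>E\<close> ahead, that \<open>N\<close> comes right after the common point.\<close>
    have i: "i \<le> length P'"
      using less cnt cntAB len' height_le_count[of i Q'] by (cases "i \<le> length P'") (auto simp: P Q)
    obtain j where j: "i = Suc j" using less by (cases i) auto
    have "height i (E # Q') \<le> height i (P' @ [E])"
      using above[of "k + i"] meet[of i] by simp
    then have le: "height j Q' \<le> height i P'" using i j by simp
    have hQ: "height i Q' = height j Q' + (if Q' ! j = N then 1 else 0)"
      using i j len' by (simp only: j height_Suc)
    have Nj: "Q' ! j = N" and hj: "height j Q' = height i P'"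
      using less le hQ by (auto split: if_splits)
    have "k + i \<le> length P" using i lenAB P by simp
    moreover have "height (k + i) ?P = height (k + i) Q"
      using meet[of i] hj i j by simp
    moreover have "Q ! (k + i) = N" using Nj j lenAB by (simp add: Q nth_append)
    ultimately show False using no_later[of "k + i"] by simp
  qed
  moreover have "count_list P' N = count_list Q' N" using cnt cntAB P Q by simp
  ultimately have "weakly_above P' Q'" using len' by (simp add: weakly_above_def)
  with P Q AB lastA show thesis using that by blast
qed

lemma weakly_above_snoc_N:
  assumes "weakly_above (P @ [N]) Q"
  obtains Q' where "Q = Q' @ [N]" "weakly_above P Q'"
proof -
  have len: "length Q = Suc (length P)" using assms by (simp add: weakly_above_def)
  then have "Q \<noteq> []" by auto
  then obtain Q' s where Q: "Q = Q' @ [s]" by (metis rev_exhaust)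
  with len have len': "length Q' = length P" by simp
  have above: "height i Q \<le> height i (P @ [N])" for i using assms by (simp add: weakly_above_def)
  have cnt: "Suc (count_list P N) = count_list Q N" using assms by (simp add: weakly_above_def)
  have s: "s = N"
    using above[of "length P"] cnt len' by (cases s) (auto simp: Q)
  have "height i Q' \<le> height i P" for i
    using above[of "min i (length P)"] len' by (simp add: Q min_def split: if_splits)
  then show thesis using that Q s len' cnt by (simp add: weakly_above_def)
qed

lemma omega_surj: "weakly_above P Q \<Longrightarrow> \<exists>T. omega1 T = P \<and> omega2 T = Q"
proof (induction "length P" arbitrary: P Q rule: less_induct)
  case less
  have left: "\<exists>l. omega1 (Node l None) = A \<and> omega2 (Node l None) = B"
    if AB: "weakly_above A B" and last: "A = [] \<or> last A = N" and len: "length A \<le> length P" for A B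
  proof (cases "A = []")
    case True
    with AB show ?thesis
      by (intro exI[of _ None]) (auto simp: weakly_above_def omega1_Node omega2_Node)
  next
    case False
    with last obtain A' where A': "A = A' @ [N]" by (metis append_butlast_last_id)
    with AB obtain B' where B': "B = B' @ [N]" "weakly_above A' B'"
      using weakly_above_snoc_N by metis
    obtain T where "omega1 T = A'" "omega2 T = B'" using less(1)[OF _ B'(2)] A' len by auto
    then show ?thesis using A' B' by (intro exI[of _ "Some T"]) (simp add: omega1_Node omega2_Node)
  qed
  show ?case
  proof (cases "P = [] \<or> last P = N")
    case True
    then show ?thesis using left[of P Q] less(2) by auto
  next
    case False
    then obtain P0 where P0: "P = P0 @ [E]"
      by (metis append_butlast_last_id step.exhaust)
    with less(2) have "weakly_above (P0 @ [E]) Q" by simp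
    then obtain A P' B Q' where s: "P0 = A @ P'" "Q = B @ E # Q'" "weakly_above A B"
      "weakly_above P' Q'" "A = [] \<or> last A = N"
      by (rule weakly_above_splitE)
    obtain l where l: "omega1 (Node l None) = A" "omega2 (Node l None) = B"
      using left[OF s(3,5)] P0 s(1) by auto
    obtain z where z: "omega1 z = P'" "omega2 z = Q'"
      using less(1)[OF _ s(4)] P0 s(1) by auto
    have "omega1 (Node l (Some z)) = P" "omega2 (Node l (Some z)) = Q"
      using l z P0 s(1,2) by (simp_all add: omega1_Node omega2_Node)
    then show ?thesis by blast
  qed
qed

lemma tree_of_paths_omega:
  assumes "weakly_above P Q" "length P = m"
  shows "omega1 (tree_of_paths m P Q) = P" "omega2 (tree_of_paths m P Q) = Q"
proof -
  have "\<exists>!T. edges T = m \<and> omega1 T = P \<and> omega2 T = Q"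
    using omega_surj[OF assms(1)] assms(2) omega_inj by (auto simp: edges_eq_length_omega1)
  from theI'[OF this] show "omega1 (tree_of_paths m P Q) = P" "omega2 (tree_of_paths m P Q) = Q"
    by (simp_all add: tree_of_paths_def)
qed

section \<open>The lowest path\<close>

lemma count_N_add_count_E: "count_list P N + count_list P E = length P"
proof (induction P)
  case (Cons s P)
  then show ?case by (cases s) auto
qed simp

lemma step_seq_from_append:
  "step_seq_from x (P @ Q) = step_seq_from x P @ step_seq_from (x + count_list P E) Q"
  by (induction x P rule: step_seq_from.induct) auto

lemma count_list_replicate_self [simp]: "count_list (replicate m x) x = m"
  by (induction m) auto

lemma step_seq_from_replicate_E [simp]: "step_seq_from x (replicate m E) = []"
  by (induction m arbitrary: x) auto

lemma length_step_seq_from [simp]: "length (step_seq_from x P) = count_list P N"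
  by (induction x P rule: step_seq_from.induct) auto

lemma step_seq_from_ge: "u \<in> set (step_seq_from x P) \<Longrightarrow> x \<le> u"
  by (induction x P rule: step_seq_from.induct) auto

lemma step_seq_from_inj:
  assumes "step_seq_from x P = step_seq_from x Q" "count_list P E = count_list Q E"
  shows "P = Q"
  using assms
proof (induction x P arbitrary: Q rule: step_seq_from.induct)
  case (1 x)
  then have "count_list Q N = 0" "count_list Q E = 0"
    using length_step_seq_from[of x Q] by auto
  then show ?case using count_N_add_count_E[of Q] by simp
next
  case (2 x P)
  then obtain s Q' where Q: "Q = s # Q'" by (cases Q) auto
  show ?case
  proof (cases s)
    case N
    with 2 Q show ?thesis by auto
  next
    case E
    then have "x \<in> set (step_seq_from (Suc x) Q')" using 2(2) Q by (metis list.set_intros(1) step_seq_from.simps(2,3))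
    then show ?thesis using step_seq_from_ge by fastforce
  qed
next
  case (3 x P)
  then obtain s Q' where Q: "Q = s # Q'" by (cases Q) auto
  show ?case
  proof (cases s)
    case N
    then have "x \<in> set (step_seq_from (Suc x) P)" using 3(2) Q by (metis list.set_intros(1) step_seq_from.simps(2,3))
    then show ?thesis using step_seq_from_ge by fastforce
  next
    case E
    with 3 Q show ?thesis by auto
  qed
qed

text \<open>
  Appending an entry \<open>u\<close> extends a path ending at abscissa \<open>u\<close>, whence the end abscissa \<open>e\<close> has to vary
  in the induction.
\<close>

lemma path_with_step_seq:
  assumes "sorted us" "\<forall>u\<in>set us. u \<le> e"
  shows "\<exists>P. step_seq P = us \<and> count_list P E = e"
  using assms
proof (induction us arbitrary: e rule: rev_induct)
  case Nil
  show ?case by (intro exI[of _ "replicate e E"]) (simp add: step_seq_def)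
next
  case (snoc u us)
  then obtain P where "step_seq P = us" "count_list P E = u"
    by (metis (no_types, lifting) Un_iff list.set_intros(1) set_append sorted_append)
  then show ?case using snoc.prems(2)
    by (intro exI[of _ "P @ N # replicate (e - u) E"]) (simp add: step_seq_def step_seq_from_append)
qed

lemma count_E_before_N:
  assumes "step_seq P = us" "P = A @ N # B"
  shows "count_list A E = us ! count_list A N"
  using assms by (auto simp: step_seq_def step_seq_from_append nth_append)

text \<open>
  The condition of staying above the line needs to be checked only just before a step \<open>N\<close>, where the
  step sequence gives the abscissa, and after the last \<open>N\<close>, where the abscissa is at most \<open>b * n\<close>.
\<close>

lemma lowest_path_props:
  assumes a: "a > 0" and b: "b > 0"
  shows lowest_path_in: "lowest_path a b n \<in> dyck_paths a b n"
    and lowest_path_step_seq: "step_seq (lowest_path a b n) = map (\<lambda>k. b * k div a) [0..<a * n]"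
proof -
  let ?us = "map (\<lambda>k. b * k div a) [0..<a * n]"
  have bound: "b * k div a \<le> b * n" if "k < a * n" for k
  proof -
    have "b * k div a \<le> b * (a * n) div a" using that by (intro div_le_mono) simp
    also have "\<dots> = b * n" using a by simp
    finally show ?thesis .
  qed
  have "sorted ?us" by (auto simp: sorted_iff_nth_mono intro!: div_le_mono)
  then obtain P where P: "step_seq P = ?us" "count_list P E = b * n"
    using path_with_step_seq[of ?us "b * n"] bound by auto
  have cN: "count_list P N = a * n"
    using arg_cong[OF P(1), of length] by (simp add: step_seq_def)
  have "a * count_list (take k P) E \<le> b * count_list (take k P) N" for k
  proof (cases "N \<in> set (drop k P)")
    case True
    then obtain B C where BC: "drop k P = B @ N # C" "N \<notin> set B"
      by (meson split_list_first)
    have PB: "P = (take k P @ B) @ N # C" using BC(1) by (metis append.assoc append_take_drop_id)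
    have NB: "count_list B N = 0" using BC(2) by simp
    have "Suc (count_list (take k P) N) \<le> count_list P N"
      by (subst PB) simp
    then have "count_list (take k P @ B) E = b * count_list (take k P) N div a"
      using count_E_before_N[OF P(1) PB] NB cN by simp
    then have "count_list (take k P) E \<le> b * count_list (take k P) N div a" by simp
    then have "a * count_list (take k P) E \<le> a * (b * count_list (take k P) N div a)" by simp
    also have "\<dots> \<le> b * count_list (take k P) N" by simp
    finally show ?thesis .
  next
    case False
    then have "count_list (drop k P) N = 0" by simp
    then have "count_list (take k P) N = a * n"
      using cN by (metis add.right_neutral append_take_drop_id count_list_append)
    moreover have "count_list (take k P) E \<le> b * n"
      using P(2) by (metis append_take_drop_id count_list_append le_add1)
    ultimately show ?thesis by (simp add: algebra_simps)
  qed
  then have "P \<in> dyck_paths a b n" using P(2) cN by (simp add: dyck_paths_def)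
  moreover have "P' = P" if "P' \<in> dyck_paths a b n" "step_seq P' = ?us" for P'
    using that P step_seq_from_inj[of 0 P' P] by (simp add: dyck_paths_def step_seq_def)
  ultimately have "\<exists>!P. P \<in> dyck_paths a b n \<and> step_seq P = ?us" using P(1) by blast
  from theI'[OF this] show "lowest_path a b n \<in> dyck_paths a b n"
    "step_seq (lowest_path a b n) = ?us" by (simp_all add: lowest_path_def)
qed

text \<open>
  At the first violation the two paths part at a common point, the lowest path with \<open>N\<close> and \<open>P\<close> with
  \<open>E\<close>.  But the lowest path steps \<open>N\<close> only where a step \<open>E\<close> would cross the line.
\<close>

lemma weakly_above_lowest_path:
  assumes a: "a > 0" and b: "b > 0" and P: "P \<in> dyck_paths a b n"
  shows "weakly_above P (lowest_path a b n)"
proof -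
  let ?Q = "lowest_path a b n"
  have Q: "?Q \<in> dyck_paths a b n" using lowest_path_in[OF a b] .
  have len: "length P = length ?Q"
    using P Q count_N_add_count_E[of P] count_N_add_count_E[of ?Q] by (simp add: dyck_paths_def)
  have "height k ?Q \<le> height k P" if "k \<le> length P" for k
    using that
  proof (induction k)
    case (Suc k)
    then have k: "k < length P" "k < length ?Q" and IH: "height k ?Q \<le> height k P" using len by auto
    show ?case
    proof (rule ccontr)
      assume less: "\<not> height (Suc k) ?Q \<le> height (Suc k) P"
      with IH have Qk: "?Q ! k = N" and Pk: "P ! k \<noteq> N" and eq: "height k ?Q = height k P"
        using height_Suc[OF k(1)] height_Suc[OF k(2)] by (auto split: if_splits)
      have Pk: "P ! k = E" using Pk by (cases "P ! k") auto
      have decQ: "?Q = take k ?Q @ N # drop (Suc k) ?Q"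
        using id_take_nth_drop[OF k(2)] Qk by simp
      have hk: "height k ?Q < a * n"
        using arg_cong[OF decQ, of "\<lambda>Q. count_list Q N"] Q by (simp add: dyck_paths_def)
      have cE: "count_list (take k P) E = count_list (take k ?Q) E"
        using count_N_add_count_E[of "take k P"] count_N_add_count_E[of "take k ?Q"] eq k by simp
      have "count_list (take k ?Q) E = b * height k ?Q div a"
        using count_E_before_N[OF lowest_path_step_seq[OF a b] decQ] hk by simp
      moreover have "a * count_list (take (Suc k) P) E \<le> b * height (Suc k) P"
        using P Suc.prems by (simp add: dyck_paths_def)
      then have "a * Suc (count_list (take k P) E) \<le> b * height k P"
        using k(1) Pk by (simp add: take_Suc_conv_app_nth)
      then have "Suc (count_list (take k P) E) \<le> b * height k P div a"
        using a by (simp add: less_eq_div_iff_mult_less_eq mult.commute)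
      ultimately show False using eq cE by simp
    qed
  qed simp
  moreover have "height k ?Q \<le> height k P" if "k > length P" for k
    using that len P Q by (simp add: dyck_paths_def)
  ultimately have "height k ?Q \<le> height k P" for k by (meson not_le)
  then show ?thesis using len P Q by (simp add: weakly_above_def dyck_paths_def)
qed

section \<open>The word of opening parentheses and stars\<close>

fun symbol_step :: "symbol \<Rightarrow> step option" where
  "symbol_step LParen = Some N"
| "symbol_step RParen = None"
| "symbol_step Star = Some E"

text \<open>
  The word $\alpha^\ast(\pi)$ without its closing parentheses, read as a lattice path; the selection of
  stars by their labels depends on nothing else.
\<close>

definition alpha_path :: "nat list \<Rightarrow> step list" where
  "alpha_path \<pi> = List.map_filter symbol_step (alpha_star \<pi>)"

lemma map_filter_append:
  "List.map_filter f (xs @ ys) = List.map_filter f xs @ List.map_filter f ys"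
  by (simp add: List.map_filter_def)

lemma map_filter_join:
  assumes "f s = Some t"
  shows "List.map_filter f (join s ws) = join t (map (List.map_filter f) ws)"
  using assms by (induction s ws rule: join.induct) (auto simp: List.map_filter_def)

lemma alpha_path_Nil [simp]: "alpha_path [] = []"
  by (simp add: alpha_path_def alpha_star.simps List.map_filter_def)

lemma alpha_path_rec:
  "\<pi> \<noteq> [] \<Longrightarrow> alpha_path \<pi> = N # join E (map alpha_path (split_at (Min (set \<pi>)) \<pi>))"
  unfolding alpha_path_def
  by (subst alpha_star.simps)
    (simp add: map_filter_append map_filter_join comp_def List.map_filter_simps)

lemma split_at_append:
  "split_at r (x @ y) =
     butlast (split_at r x) @ (last (split_at r x) @ hd (split_at r y)) # tl (split_at r y)"
proof (induction x)
  case (Cons z x)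
  then show ?case by (cases "split_at r x") auto
qed simp

lemma split_at_notin: "r \<notin> set x \<Longrightarrow> split_at r x = [x]"
  by (induction x) auto

lemma split_at_replicate: "split_at r (replicate m r) = replicate (Suc m) []"
  by (induction m) auto

lemma join_replicate_Nil: "join s (replicate (Suc m) []) = replicate m s"
  by (induction m) auto

lemma join_append_Cons:
  "join s (ws @ w # vs) = concat (map (\<lambda>w. w @ [s]) ws) @ w @ concat (map ((#) s) vs)"
proof (induction ws)
  case Nil
  show ?case by (induction vs arbitrary: w) auto
next
  case (Cons u ws)
  have "join s (u # ws @ w # vs) = u @ s # join s (ws @ w # vs)" by (cases ws) auto
  with Cons show ?case by simp
qed

lemma set_split_at: "p \<in> set (split_at r x) \<Longrightarrow> set p \<subseteq> set x"
proof (induction x arbitrary: p)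
  case (Cons z x)
  obtain q qs where "split_at r x = q # qs" by (cases "split_at r x") auto
  with Cons show ?case by (fastforce split: if_splits)
qed simp

text \<open>
  The additional \<open>Suc\<close> in each summand counts one separator per piece, that is, one more than there are.
\<close>

lemma sum_length_split_at:
  "(\<Sum>p\<leftarrow>split_at r x. Suc (length p)) = Suc (length x)"
proof (induction x)
  case (Cons z x)
  then show ?case by (cases "split_at r x") auto
qed simp

lemma count_E_join:
  "ws \<noteq> [] \<Longrightarrow> Suc (count_list (join E ws) E) = (\<Sum>w\<leftarrow>ws. Suc (count_list w E))"
  by (induction E ws rule: join.induct) auto

lemma count_E_alpha_path: "count_list (alpha_path \<pi>) E = length \<pi>"
proof (induction "length \<pi>" arbitrary: \<pi> rule: less_induct)
  case less
  show ?case
  proof (cases "\<pi> = []")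
    case False
    let ?ps = "split_at (Min (set \<pi>)) \<pi>"
    have IH: "count_list (alpha_path p) E = length p" if "p \<in> set ?ps" for p
      using less length_split_at_less[OF Min_in that] False by auto
    have "Suc (count_list (alpha_path \<pi>) E) = Suc (count_list (join E (map alpha_path ?ps)) E)"
      using False by (simp add: alpha_path_rec)
    also have "\<dots> = (\<Sum>p\<leftarrow>?ps. Suc (count_list (alpha_path p) E))"
      by (subst count_E_join) (simp_all add: comp_def)
    also have "\<dots> = (\<Sum>p\<leftarrow>?ps. Suc (length p))"
      by (intro arg_cong[of _ _ sum_list] map_cong) (simp_all add: IH)
    also have "\<dots> = Suc (length \<pi>)" by (rule sum_length_split_at)
    finally show ?thesis by simp
  qed simp
qed

text \<open>
  A block of a largest letter enters one piece of each decomposition on the way down, until it reaches an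
  empty piece, which contributes nothing before and \<open>N\<close> with \<open>b\<close> stars afterwards.  Between the
  insertion point and the next star only closing parentheses can occur; this is the last
  conjunct, and it determines \<open>A\<close> and \<open>B\<close>, since \<open>A\<close> has as many stars as \<open>x\<close> has letters.
\<close>

lemma alpha_path_insert:
  assumes "b > 0" "\<forall>l \<in> set (x @ y). l < k"
  shows "\<exists>A B. alpha_path (x @ y) = A @ B \<and>
    alpha_path (x @ replicate b k @ y) = A @ N # replicate b E @ B \<and>
    count_list A E = length x \<and> (B = [] \<or> hd B = E)"
  using assms(2)
proof (induction "length (x @ y)" arbitrary: x y rule: less_induct)
  case less
  show ?case
  proof (cases "x @ y = []")
    case True
    have "Min (set (replicate b k)) = k" using assms(1) by simp
    then have "alpha_path (replicate b k) =
        N # join E (map alpha_path (replicate (Suc b) []))"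
      using assms(1) alpha_path_rec[of "replicate b k"] by (simp only: split_at_replicate) simp
    also have "map alpha_path (replicate (Suc b) []) = replicate (Suc b) []" by simp
    finally have "alpha_path (replicate b k) = N # replicate b E"
      by (simp only: join_replicate_Nil)
    with True show ?thesis by simp
  next
    case False
    define r where "r = Min (set (x @ y))"
    have r: "r \<in> set (x @ y)" unfolding r_def using False by (intro Min_in) auto
    then have rk: "r < k" using less.prems by blast
    have nonempty: "x @ replicate b k @ y \<noteq> []" using False by auto
    have Min: "Min (set (x @ replicate b k @ y)) = r"
    proof (rule Min_eqI)
      show "r \<le> l" if "l \<in> set (x @ replicate b k @ y)" for l
        using that rk by (auto simp: r_def split: if_splits)
      show "r \<in> set (x @ replicate b k @ y)" using r by auto
    qed simp
    obtain ps p where x: "split_at r x = ps @ [p]"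
      by (metis rev_exhaust split_at_not_Nil)
    obtain q qs where y: "split_at r y = q # qs"
      by (metis neq_Nil_conv split_at_not_Nil)
    have xy: "split_at r (x @ y) = ps @ (p @ q) # qs"
      by (simp add: split_at_append x y)
    have "split_at r (replicate b k @ y) = (replicate b k @ q) # qs"
      using rk by (simp add: split_at_append split_at_notin y)
    then have xky: "split_at r (x @ replicate b k @ y) = ps @ (p @ replicate b k @ q) # qs"
      by (simp add: split_at_append x)
    have pq: "p @ q \<in> set (split_at r (x @ y))" by (simp add: xy)
    have "\<forall>l \<in> set (p @ q). l < k" using set_split_at[OF pq] less.prems by blast
    then obtain A B where AB: "alpha_path (p @ q) = A @ B"
      "alpha_path (p @ replicate b k @ q) = A @ N # replicate b E @ B"
      "count_list A E = length p" "B = [] \<or> hd B = E"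
      using less.hyps[OF length_split_at_less[OF r pq]] by blast
    let ?A = "N # concat (map (\<lambda>p. alpha_path p @ [E]) ps) @ A"
    let ?B = "B @ concat (map (\<lambda>p. E # alpha_path p) qs)"
    have "alpha_path (x @ y) = ?A @ ?B"
      unfolding alpha_path_rec[OF False] r_def[symmetric] xy
      by (simp add: join_append_Cons AB(1) comp_def)
    moreover have "alpha_path (x @ replicate b k @ y) = ?A @ N # replicate b E @ ?B"
      unfolding alpha_path_rec[OF nonempty] Min xky
      by (simp add: join_append_Cons AB(2) comp_def)
    moreover have "count_list ?A E = length x"
    proof -
      have "count_list (concat (map (\<lambda>p. alpha_path p @ [E]) ps)) E = (\<Sum>p\<leftarrow>ps. Suc (length p))"
        by (induction ps) (simp_all add: count_E_alpha_path)
      then show ?thesis using sum_length_split_at[of r x] AB(3) by (simp add: x)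
    qed
    moreover have "?B = [] \<or> hd ?B = E" using AB(4) by (cases B; cases qs) auto
    ultimately show ?thesis by blast
  qed
qed

lemma zeta_snoc:
  "zeta b (us @ [u]) =
     take u (zeta b us) @ replicate b (Suc (length us)) @ drop u (zeta b us)"
proof -
  have "zip [1..<Suc (Suc (length us))] (us @ [u]) =
      zip [1..<Suc (length us)] us @ [(Suc (length us), u)]"
    using zip_append[of "[1..<Suc (length us)]" us "[Suc (length us)]" "[u]"]
    by (subst upt_Suc_append) (simp_all del: upt_Suc)
  then show ?thesis by (simp add: zeta_def insert_block_def del: upt_Suc)
qed

lemma set_zeta: "set (zeta b us) \<subseteq> {..length us}"
proof (induction us rule: rev_induct)
  case (snoc u us)
  then show ?case
    using set_take_subset[of u "zeta b us"] set_drop_subset[of u "zeta b us"]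
    by (fastforce simp: zeta_snoc split: if_splits)
qed (simp add: zeta_def)

lemma length_zeta: "length (zeta b us) = b * length us"
proof (induction us rule: rev_induct)
  case (snoc u us)
  have "length (take u w) + length (drop u w) = length w" for w :: "nat list"
    by (metis append_take_drop_id length_append)
  from this[of "zeta b us"] snoc show ?case by (simp add: zeta_snoc)
qed (simp add: zeta_def)

text \<open>
  The step sequence ignores a final \<open>E\<close>, which is thus taken from the padding; the bound on prefixes
  guarantees that some padding is left.  For a final \<open>N\<close> the step sequence gets the new entry
  \<open>count_list P E\<close>, so the insertion point lies exactly between \<open>P\<close> and its padding.
\<close>

lemma alpha_path_zeta:
  assumes b: "b > 0" and P: "\<And>A B. P = A @ B \<Longrightarrow> count_list A E \<le> b * count_list A N"
  shows "alpha_path (zeta b (step_seq P)) =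
    P @ replicate (b * count_list P N - count_list P E) E"
  using P
proof (induction P rule: rev_induct)
  case Nil
  show ?case by (simp add: step_seq_def zeta_def)
next
  case (snoc s P)
  let ?d = "b * count_list P N - count_list P E"
  have IH: "alpha_path (zeta b (step_seq P)) = P @ replicate ?d E"
    by (rule snoc.IH) (metis append.assoc snoc.prems)
  show ?case
  proof (cases s)
    case E
    have "count_list (P @ [E]) E \<le> b * count_list (P @ [E]) N" using snoc.prems[of "P @ [s]" "[]"] E by simp
    then have "?d = Suc (b * count_list P N - Suc (count_list P E))" by simp
    with IH show ?thesis by (simp add: E step_seq_def step_seq_from_append)
  next
    case N
    let ?u = "count_list P E" and ?us = "step_seq P"
    let ?x = "take ?u (zeta b ?us)" and ?y = "drop ?u (zeta b ?us)"
    have len: "length ?us = count_list P N" by (simp add: step_seq_def)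
    have u: "?u \<le> b * count_list P N" using snoc.prems[of P "[s]"] by simp
    have "\<forall>l \<in> set (?x @ ?y). l < Suc (length ?us)"
      using set_zeta[of b ?us] by auto
    from alpha_path_insert[OF b this] obtain A B
      where AB: "alpha_path (zeta b ?us) = A @ B"
        "alpha_path (?x @ replicate b (Suc (length ?us)) @ ?y) = A @ N # replicate b E @ B"
        "count_list A E = length ?x" "B = [] \<or> hd B = E"
      by auto
    have cA: "count_list A E = ?u" using AB(3) u len by (simp add: length_zeta)
    \<comment> \<open>An overlap of \<open>A\<close> with the padding, or of \<open>B\<close> with \<open>P\<close>, would be free of \<open>E\<close>s,\<close>
    \<comment> \<open>although the padding consists of \<open>E\<close>s and \<open>B\<close> starts with \<open>E\<close>.\<close>
    have "P @ replicate ?d E = A @ B" using IH AB(1) by simp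
    then obtain D where "A = P @ D \<and> replicate ?d E = D @ B \<or> P = A @ D \<and> D @ replicate ?d E = B"
      unfolding append_eq_append_conv2 by blast
    then have "A = P \<and> B = replicate ?d E"
    proof
      assume *: "A = P @ D \<and> replicate ?d E = D @ B"
      then have "set D \<subseteq> {E}" by (metis in_set_replicate set_append Un_iff singletonI subsetI)
      moreover have "count_list D E = 0" using * cA by simp
      ultimately have "D = []" by (cases D) auto
      with * show ?thesis by simp
    next
      assume *: "P = A @ D \<and> D @ replicate ?d E = B"
      then have "count_list D E = 0" using cA by simp
      then have "D = []" using * AB(4) by (cases D) auto
      with * show ?thesis by (metis append_Nil append_Nil2)
    qed
    moreover have "zeta b (step_seq (P @ [N])) = ?x @ replicate b (Suc (length ?us)) @ ?y"
      by (simp add: step_seq_def step_seq_from_append zeta_snoc)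
    moreover have "b * count_list (P @ [N]) N - count_list (P @ [N]) E = b + ?d" using u by simp
    ultimately show ?thesis using AB(2) by (simp add: N replicate_add)
  qed
qed

section \<open>Residue classes of positions\<close>

text \<open>
  Stars are labelled from the right, so positions are counted here from the right end as well.  The
  offset \<open>c\<close> is the length of a further word to the right, which allows splitting the word.
\<close>

fun pick_residue :: "nat \<Rightarrow> nat \<Rightarrow> nat \<Rightarrow> 'a list \<Rightarrow> 'a list" where
  "pick_residue b j c [] = []"
| "pick_residue b j c (x # xs) =
     (if (c + length xs) mod b + 1 = j then x # pick_residue b j c xs else pick_residue b j c xs)"

lemma pick_residue_append:
  "pick_residue b j c (xs @ ys) = pick_residue b j (c + length ys) xs @ pick_residue b j c ys"
  by (induction xs) (auto simp: ac_simps)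

lemma pick_residue_none:
  "(\<And>i. i < length xs \<Longrightarrow> (c + i) mod b + 1 \<noteq> j) \<Longrightarrow> pick_residue b j c xs = []"
  by (induction xs) auto

lemma add_mod_inj:
  fixes b c d d' :: nat
  assumes "(c + d) mod b = (c + d') mod b" "d < b" "d' < b"
  shows "d = d'"
proof -
  have le: "d = d'" if eq: "(c + d) mod b = (c + d') mod b" and "d < b" and "d' \<le> d" for d d'
  proof -
    have "c + d' \<le> c + d" using \<open>d' \<le> d\<close> by simp
    with eq obtain q where "c + d = c + d' + b * q" by (rule mod_eq_nat1E)
    then show ?thesis using \<open>d < b\<close> by (cases q) auto
  qed
  show ?thesis using le[of d d'] le[of d' d] assms by (cases "d' \<le> d") auto
qed

text \<open>
  Among \<open>b\<close> consecutive positions exactly one has the given residue; \<open>d\<close> is its distance from the right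
  end of the block.
\<close>

lemma pick_residue_block:
  assumes j: "1 \<le> j" "j \<le> b" and len: "length xs = b"
  shows "\<exists>d<b. pick_residue b j c xs = [xs ! (b - 1 - d)] \<and> (c + d) mod b + 1 = j"
proof -
  \<comment> \<open>the residue of \<open>j - 1 - c\<close>, written without a truncated difference\<close>
  define d where "d = (j - 1 + (b - c mod b)) mod b"
  have d: "d < b" using j by (simp add: d_def)
  have cb: "c mod b < b" using j by simp
  have "(c + d) mod b = (c mod b + (j - 1 + (b - c mod b))) mod b"
    unfolding d_def by (simp add: mod_simps)
  also have "c mod b + (j - 1 + (b - c mod b)) = (j - 1) + b" using cb by simp
  also have "\<dots> mod b = j - 1" using j by (subst mod_add_self2) simp
  finally have dj: "(c + d) mod b + 1 = j" using j by simp
  have other: "(c + i) mod b + 1 \<noteq> j" if "i < b" "i \<noteq> d" for i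
    using add_mod_inj[of c i b d] that d dj by auto
  define k where "k = b - 1 - d"
  have k: "k < length xs" using d len by (simp add: k_def)
  have kd: "length (drop (Suc k) xs) = d" using d len by (simp add: k_def)
  have "pick_residue b j c xs = pick_residue b j c (take k xs @ xs ! k # drop (Suc k) xs)"
    using id_take_nth_drop[OF k] by simp
  also have "\<dots> = pick_residue b j (c + Suc d) (take k xs) @
      xs ! k # pick_residue b j c (drop (Suc k) xs)"
    using dj kd by (simp add: pick_residue_append)
  also have "pick_residue b j (c + Suc d) (take k xs) = []"
  proof (rule pick_residue_none)
    fix i assume "i < length (take k xs)"
    then have "Suc d + i < b" using d by (auto simp: k_def)
    then show "(c + Suc d + i) mod b + 1 \<noteq> j" using other[of "Suc d + i"] by (simp add: add.assoc)
  qed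
  also have "pick_residue b j c (drop (Suc k) xs) = []"
    using other kd d by (intro pick_residue_none) simp
  finally show ?thesis using d dj by (auto simp: k_def)
qed

lemma residue_word_append:
  assumes "length xs = b" "j \<le> b"
  shows "residue_word b (Suc m) (xs @ w) j = (xs @ w) ! (b - j) # residue_word b m w j"
proof -
  have eq: "[1..<Suc (Suc m)] = 1 # map Suc [1..<Suc m]"
    by (simp add: map_Suc_upt upt_conv_Cons del: upt_Suc)
  have "(xs @ w) ! (Suc k * b - j) = w ! (k * b - j)" if "1 \<le> k" for k
  proof -
    have "j \<le> k * b" using that assms(2) by (metis le_trans mult_1 mult_le_mono1)
    then have "Suc k * b - j = length xs + (k * b - j)" using assms(1) by simp
    then show ?thesis by (simp add: nth_append)
  qed
  then show ?thesis unfolding residue_word_def eq by (simp del: upt_Suc)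
qed

lemma residue_word_eq_pick_residue:
  assumes j: "1 \<le> j" "j \<le> b" and "length w = m * b"
  shows "residue_word b m w j = pick_residue b j 0 w"
  using assms(3)
proof (induction m arbitrary: w)
  case 0
  then show ?case by (simp add: residue_word_def)
next
  case (Suc m)
  let ?x = "take b w" and ?w = "drop b w"
  have len: "length ?x = b" "length ?w = m * b" using Suc.prems by auto
  obtain d where d: "d < b" "pick_residue b j (m * b) ?x = [?x ! (b - 1 - d)]" "(m * b + d) mod b + 1 = j"
    using pick_residue_block[OF j len(1)] by blast
  have "j = Suc d" using d(1,3) by simp
  then have dj: "b - 1 - d = b - j" by simp
  have "residue_word b (Suc m) (?x @ ?w) j = (?x @ ?w) ! (b - j) # pick_residue b j 0 ?w"
    unfolding residue_word_append[OF len(1) j(2)] Suc.IH[OF len(2)] ..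
  moreover have "pick_residue b j 0 (?x @ ?w) = [?x ! (b - j)] @ pick_residue b j 0 ?w"
    unfolding pick_residue_append using d(2) dj len(2) by simp
  moreover have "(?x @ ?w) ! (b - j) = ?x ! (b - j)"
    using j len(1) by (subst nth_append) simp
  ultimately show ?case by (simp only: append_take_drop_id append_Cons append_Nil)
qed

text \<open>
  The counterpart of \<^term>\<open>select_stars\<close> on the words \<^term>\<open>alpha_path \<pi>\<close>.
\<close>

fun select_E :: "nat \<Rightarrow> nat \<Rightarrow> step list \<Rightarrow> step list" where
  "select_E b i [] = []"
| "select_E b i (N # w) = N # select_E b i w"
| "select_E b i (E # w) =
     (if count_list w E mod b + 1 = i then E # select_E b i w else select_E b i w)"

lemma count_E_map_filter_symbol_step:
  "count_list (List.map_filter symbol_step w) E = count_list w Star"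
proof (induction w)
  case (Cons s w)
  then show ?case by (cases s) (simp_all add: List.map_filter_simps)
qed (simp add: List.map_filter_simps)

lemma select_stars_eq_select_E:
  "select_stars b i w = select_E b i (List.map_filter symbol_step w)"
  by (induction b i w rule: select_stars.induct)
    (simp_all add: List.map_filter_simps count_E_map_filter_symbol_step)

lemma length_stretch_N: "length (stretch_N b W) = b * count_list W N + count_list W E"
proof (induction W)
  case (Cons s W)
  then show ?case by (cases s) auto
qed simp

text \<open>
  Each group of \<open>b\<close> copies of \<open>N\<close> contributes one \<open>N\<close> and does not change the residues of the positions
  to its left.  Hence the residue of the position of an \<open>E\<close> depends only on the number of \<open>E\<close>s to its
  right, as its label does.
\<close>

lemma pick_residue_stretch_N:
  assumes j: "1 \<le> j" "j \<le> b"
  shows "pick_residue b j 0 (stretch_N b W) = select_E b j W"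
proof (induction W)
  case (Cons s W)
  show ?case
  proof (cases s)
    case N
    obtain d where "d < b" "pick_residue b j (length (stretch_N b W)) (replicate b N) =
        [replicate b N ! (b - 1 - d)]"
      using pick_residue_block[OF j length_replicate, of "length (stretch_N b W)" N] by blast
    with Cons N show ?thesis by (simp add: pick_residue_append)
  next
    case E
    with Cons show ?thesis by (simp add: length_stretch_N)
  qed
qed simp

text \<open>
  The padding by \<open>(a - 1) * b * n\<close> steps \<open>E\<close> of the expanded tree is the padding in \<open>alpha_path_zeta\<close>:
  the \<open>a * n\<close> blocks give \<open>b * a * n\<close> stars, and \<open>b * n\<close> of them are steps of \<open>P\<close>.
\<close>

lemma residue_words_stretch_N:
  assumes a: "a > 0" and b: "b > 0" and P: "P \<in> dyck_paths a b n"
  shows "residue_words b (2 * a * n) (stretch_N b P @ replicate ((a - 1) * b * n) E) = alpha_II b P"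
proof -
  define W where "W = P @ replicate ((a - 1) * b * n) E"
  have stretch: "stretch_N b P @ replicate ((a - 1) * b * n) E = stretch_N b W"
    by (simp add: W_def)
  have cP: "count_list P E = b * n" "count_list P N = a * n" using P by (simp_all add: dyck_paths_def)
  have split: "(a - 1) * b * n + b * n = a * b * n" using a by (cases a) (simp_all add: algebra_simps)
  have cN: "count_list (replicate m E) N = 0" for m by (induction m) auto
  have len: "length (stretch_N b W) = 2 * a * n * b"
    using split by (simp add: length_stretch_N W_def cP cN)
  have prefix: "count_list A E \<le> b * count_list A N" if "P = A @ B" for A B
  proof -
    have "a * count_list A E \<le> b * count_list A N"
      using P that by (auto simp: dyck_paths_def dest: spec[of _ "length A"])
    moreover have "count_list A E \<le> a * count_list A E" using a by simp
    ultimately show ?thesis by linarith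
  qed
  have "b * count_list P N - count_list P E = (a - 1) * b * n"
    using split by (simp add: cP ac_simps)
  then have W: "alpha_path (zeta b (step_seq P)) = W"
    using alpha_path_zeta[OF b prefix] by (simp add: W_def)
  have "residue_word b (2 * a * n) (stretch_N b W) j =
      select_stars b j (alpha_star (zeta b (step_seq P)))" if "j \<in> set [1..<Suc b]" for j
    using that residue_word_eq_pick_residue[OF _ _ len, of j] pick_residue_stretch_N[of j b W]
    unfolding select_stars_eq_select_E alpha_path_def[symmetric] W by (auto simp del: upt_Suc)
  then show ?thesis
    unfolding stretch residue_words_def alpha_II_def alpha_II_word_def by (intro map_cong refl)
qed

theorem proposition7p8:
  fixes a b n :: nat and P :: "step list"
  assumes "a > 0" and "b > 0" and "coprime a b" and "n \<ge> 1"
    and "P \<in> dyck_paths a b n"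
  shows "residue_words b (2 * a * n) (omega1 (expanded_tree a b n P)) = alpha_II b P
       \<and> residue_words b (2 * a * n) (omega2 (expanded_tree a b n P))
         = alpha_II b (lowest_path a b n)"
proof -
  have above: "weakly_above P (lowest_path a b n)"
    using weakly_above_lowest_path assms(1,2,5) .
  have len: "length P = (a + b) * n"
    using assms(5) count_N_add_count_E[of P] by (simp add: dyck_paths_def algebra_simps)
  have "omega1 (expanded_tree a b n P) = stretch_N b P @ replicate ((a - 1) * b * n) E"
    "omega2 (expanded_tree a b n P) =
      stretch_N b (lowest_path a b n) @ replicate ((a - 1) * b * n) E"
    using tree_of_paths_omega[OF above len] assms(2)
    by (simp_all add: expanded_tree_def omega_attach_right_edges omega_divide_left)
  then show ?thesis
    using residue_words_stretch_N[OF assms(1,2)] assms(5) lowest_path_in[OF assms(1,2)] by simp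
qed

end
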